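(* Let $G$ be a finite simple graph and let $e=(a,b)$ be an edge of $G$. Then the edge refinement $G+e$ is homotopic to $G$.
   Context: For a vertex $x$ of a finite simple graph, the unit sphere $S(x)$ is the subgraph induced by the neighbors of $x$. The edge refinement $G+e$ with $e=(a,b)$ is the graph obtained from $G$ by removing the edge $e$, adding a new vertex (also called $e$), and connecting this new vertex to $a$, to $b$, and to every vertex in $S(a)\cap S(b)$. Contractible graphs are defined recursively: the one-point graph $K_1$ is contractible; a graph $B$ is contractible if there is a vertex $v$ such that both $S(v)$ and $B-v$ (the graph induced by the vertices other than $v$) are contractible. A homotopy step is either removing a vertex $v$ (with its edges) for which $S(v)$ is contractible, or the reverse: choosing a contractible (induced) subgraph $C$ of a graph and adding a new vertex $v$ connected exactly to all vertices of $C$. Two finite simple graphs are homotopic if one is obtained from the other, up to isomorphism, by finitely many homotopy steps. *)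

theory Defs
  imports "Graph_Theory.Graph_Theory"
begin

(* A finite simple graph is a "pair_graph": an undirected edge {a,b} is represented by the two
   arcs (a,b) and (b,a).  The empty graph is allowed. *)

definition nbrs :: "'a pair_pre_digraph \<Rightarrow> 'a \<Rightarrow> 'a set" where
  "nbrs G x = {y. x \<rightarrow>\<^bsub>G\<^esub> y}"

definition induced :: "'a pair_pre_digraph \<Rightarrow> 'a set \<Rightarrow> 'a pair_pre_digraph" where
  "induced G S = \<lparr>pverts = S, parcs = {(x, y) \<in> parcs G. x \<in> S \<and> y \<in> S}\<rparr>"

lemma with_proj_induced: "with_proj (induced G S) = with_proj G \<restriction> S"
  by (auto simp: with_proj_def induced_def induce_subgraph_def)

definition unit_sphere :: "'a pair_pre_digraph \<Rightarrow> 'a \<Rightarrow> 'a pair_pre_digraph" where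
  "unit_sphere G x = induced G (nbrs G x)"

definition remove_vert :: "'a pair_pre_digraph \<Rightarrow> 'a \<Rightarrow> 'a pair_pre_digraph" where
  "remove_vert G v = induced G (pverts G - {v})"

definition attach_vert :: "'a pair_pre_digraph \<Rightarrow> 'a \<Rightarrow> 'a set \<Rightarrow> 'a pair_pre_digraph" where
  "attach_vert G v C =
     \<lparr>pverts = insert v (pverts G), parcs = parcs G \<union> {v} \<times> C \<union> C \<times> {v}\<rparr>"

inductive contractible_graph :: "'a pair_pre_digraph \<Rightarrow> bool" where
  one_point: "contractible_graph \<lparr>pverts = {v}, parcs = {}\<rparr>"
| step: "\<lbrakk>pair_graph B; v \<in> pverts B;
          contractible_graph (unit_sphere B v); contractible_graph (remove_vert B v)\<rbrakk>
         \<Longrightarrow> contractible_graph B"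

inductive homotopy_step :: "'a pair_pre_digraph \<Rightarrow> 'a pair_pre_digraph \<Rightarrow> bool" where
  remove: "\<lbrakk>v \<in> pverts G; contractible_graph (unit_sphere G v)\<rbrakk>
           \<Longrightarrow> homotopy_step G (remove_vert G v)"
| extend: "\<lbrakk>C \<subseteq> pverts G; contractible_graph (induced G C); v \<notin> pverts G\<rbrakk>
           \<Longrightarrow> homotopy_step G (attach_vert G v C)"

(* The vertex types of G and H may be different, and may be finite and hence too small to supply
   the new vertices needed along a sequence of steps.  The steps are therefore carried out on
   isomorphic copies with vertices in nat, where every finite graph has a copy and a fresh vertex
   always exists. *)
definition homotopic_graphs :: "'a pair_pre_digraph \<Rightarrow> 'b pair_pre_digraph \<Rightarrow> bool" where
  "homotopic_graphs G H \<longleftrightarrow>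
     (\<exists>K L :: nat pair_pre_digraph.
        digraph_iso (with_proj G) (with_proj K) \<and>
        homotopy_step\<^sup>*\<^sup>* K L \<and>
        digraph_iso (with_proj L) (with_proj H))"

(* Old vertices x become Some x; the new vertex is None. *)
definition edge_refinement :: "'a pair_pre_digraph \<Rightarrow> 'a \<times> 'a \<Rightarrow> 'a option pair_pre_digraph" where
  "edge_refinement G e = (case e of (a, b) \<Rightarrow>
     attach_vert
       \<lparr>pverts = Some ` pverts G,
        parcs = {(Some x, Some y) | x y. (x, y) \<in> parcs G - {(a, b), (b, a)}}\<rparr>
       None
       (Some ` ({a, b} \<union> pverts (unit_sphere G a) \<inter> pverts (unit_sphere G b))))"

lemma pverts_unit_sphere: "pverts (unit_sphere G x) = nbrs G x"
  by (simp add: unit_sphere_def induced_def)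

lemma pair_graph_induced:
  assumes "pair_graph G" "S \<subseteq> pverts G"
  shows "pair_graph (induced G S)"
proof -
  interpret pair_graph G by fact
  have "finite S" using assms(2) pair_finite_verts by (rule finite_subset)
  moreover have "finite (parcs (induced G S))"
    by (rule finite_subset[OF _ pair_finite_arcs]) (auto simp: induced_def)
  ultimately show ?thesis
    by unfold_locales
       (auto simp: induced_def symmetric_def intro!: symI dest: arcs_symmetric no_loops')
qed

lemma pair_graph_attach_vert:
  assumes "pair_graph G" "C \<subseteq> pverts G" "v \<notin> pverts G"
  shows "pair_graph (attach_vert G v C)"
proof -
  interpret pair_graph G by fact
  have "finite C" using assms(2) pair_finite_verts by (rule finite_subset)
  then show ?thesis using assms(2,3) pair_finite_verts pair_finite_arcs
    by unfold_locales
       (auto simp: attach_vert_def symmetric_def intro!: symI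
             dest: arcs_symmetric no_loops' in_arcsD1 in_arcsD2)
qed

lemma homotopy_step_pair_graph:
  assumes "homotopy_step G H" "pair_graph G"
  shows "pair_graph H"
  using assms
  by cases (auto simp: remove_vert_def intro: pair_graph_induced pair_graph_attach_vert)

lemma pair_graph_edge_refinement:
  assumes "pair_graph G" "(a, b) \<in> parcs G"
  shows "pair_graph (edge_refinement G (a, b))"
proof -
  interpret pair_graph G by fact
  let ?P = "{(Some x, Some y) | x y. (x, y) \<in> parcs G - {(a, b), (b, a)}}"
  let ?D = "\<lparr>pverts = Some ` pverts G, parcs = ?P\<rparr>"
  have "?P \<subseteq> map_prod Some Some ` parcs G" by force
  then have "finite ?P" by (rule finite_subset) (simp add: pair_finite_arcs)
  then have "pair_graph ?D"
    by unfold_locales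
       (auto simp: symmetric_def pair_finite_verts intro!: symI
             dest: arcs_symmetric no_loops' in_arcsD1 in_arcsD2)
  then show ?thesis
    unfolding edge_refinement_def prod.case
    by (rule pair_graph_attach_vert)
       (use assms(2) in \<open>auto simp: pverts_unit_sphere nbrs_def dest: in_arcsD1 in_arcsD2\<close>)
qed

end

theory Submission
  imports Defs
begin

text \<open>
  Write \<open>H\<close> for the edge refinement and \<open>e\<close> for its new vertex.  Homotopy steps change
  vertices only, so the missing edge between \<open>a\<close> and \<open>b\<close> cannot be put back directly.  Instead
  \<open>a\<close> is exchanged for a new vertex \<open>a'\<close> that also sees \<open>b\<close>, in three steps:
  \<^item> attach \<open>a'\<close> to \<open>a\<close>, to \<open>b\<close> and to all neighbours of \<open>a\<close>;
  \<^item> remove \<open>a\<close>, whose neighbours other than \<open>a'\<close> are all neighbours of \<open>a'\<close>;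
  \<^item> remove \<open>e\<close>, whose remaining neighbours other than \<open>a'\<close> (namely \<open>b\<close> and the common
    neighbours of \<open>a\<close> and \<open>b\<close> in \<open>G\<close>) are all neighbours of \<open>a'\<close>.

  What is left is \<open>G\<close> with \<open>a\<close> renamed to \<open>a'\<close>.  Each step is legitimate because a cone (a graph
  with a vertex adjacent to all others) is contractible: this is \<open>contractible_cone\<close>.  The two
  removals have unit spheres that are cones with apex \<open>a'\<close>.  The graph to which \<open>a'\<close> is attached
  is not a cone, but it is a cone with apex \<open>a\<close> to which \<open>b\<close> has been added along the common
  neighbours of \<open>a\<close> and \<open>b\<close> in \<open>H\<close>; these include \<open>e\<close>, which is adjacent to all the others, so
  they too form a cone.  This last point is where the refining vertex is needed.

  Homotopy is witnessed on vertices in \<open>nat\<close>, so the three steps are carried out on a renamed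
  copy of \<open>H\<close>, with a number not yet in use as \<open>a'\<close>.
\<close>

section \<open>Cones are contractible\<close>

lemma mem_nbrs_iff: "y \<in> nbrs G x \<longleftrightarrow> (x, y) \<in> parcs G"
  by (simp add: nbrs_def)

lemma unit_sphere_induced:
  "x \<in> S \<Longrightarrow> unit_sphere (induced G S) x = induced G (S \<inter> nbrs G x)"
  by (auto simp: unit_sphere_def induced_def nbrs_def)

lemma remove_vert_induced: "remove_vert (induced G S) x = induced G (S - {x})"
  by (auto simp: remove_vert_def induced_def)

text \<open>Unit spheres and vertex deletions at a vertex other than the apex are again cones with the
  same apex, so the recursive definition of contractibility can be run down to the apex alone.\<close>

lemma contractible_cone:
  assumes "pair_graph G" "v \<in> pverts G" "T \<subseteq> nbrs G v"
  shows "contractible_graph (induced G (insert v T))"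
proof -
  interpret pair_graph G by fact
  have nbrs_sub: "nbrs G v \<subseteq> pverts G" by (auto simp: mem_nbrs_iff dest: in_arcsD2)
  have "finite T" using assms(3) nbrs_sub pair_finite_verts by (meson finite_subset)
  then show ?thesis using assms(3)
  proof (induction T rule: finite_psubset_induct)
    case (psubset T)
    show ?case
    proof (cases "T = {}")
      case True
      have "induced G {v} = \<lparr>pverts = {v}, parcs = {}\<rparr>"
        by (auto simp: induced_def dest: no_loops')
      with True show ?thesis by (simp add: contractible_graph.one_point)
    next
      case False
      then obtain w where w: "w \<in> T" by blast
      have wv: "w \<noteq> v" "v \<in> nbrs G w" and ww: "w \<notin> nbrs G w"
        using subsetD[OF psubset.prems w] by (auto simp: mem_nbrs_iff dest: arcs_symmetric no_loops')
      show ?thesis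
      proof (rule contractible_graph.step[where v = w])
        show "pair_graph (induced G (insert v T))"
          using assms nbrs_sub psubset.prems by (intro pair_graph_induced) auto
        show "w \<in> pverts (induced G (insert v T))" using w by (simp add: induced_def)
        have "contractible_graph (induced G (insert v (T \<inter> nbrs G w)))"
          using w ww psubset.prems by (intro psubset.IH) auto
        then show "contractible_graph (unit_sphere (induced G (insert v T)) w)"
          using w wv by (simp add: unit_sphere_induced)
        have "contractible_graph (induced G (insert v (T - {w})))"
          using w psubset.prems by (intro psubset.IH) auto
        then show "contractible_graph (remove_vert (induced G (insert v T)) w)"
          using wv by (simp add: remove_vert_induced insert_Diff_if)
      qed
    qed
  qed
qed

section \<open>Exchanging an endpoint\<close>

text \<open>The three steps described above, for an arbitrary graph in which \<open>e\<close> sits like a refining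
  vertex between the non-adjacent vertices \<open>a\<close> and \<open>b\<close>.\<close>

lemma homotopy_steps_exchange_endpoint:
  assumes H: "pair_graph H"
    and b: "b \<in> pverts H" "b \<noteq> a" "b \<notin> nbrs H a"
    and e: "nbrs H e = {a, b} \<union> (nbrs H a \<inter> nbrs H b - {e})"
    and a': "a' \<notin> pverts H"
  shows "homotopy_step\<^sup>*\<^sup>* H
    (remove_vert (remove_vert (attach_vert H a' (insert a (insert b (nbrs H a)))) a) e)"
proof -
  interpret pair_graph H by fact
  have sym: "y \<in> nbrs H x \<longleftrightarrow> x \<in> nbrs H y" for x y
    by (auto simp: mem_nbrs_iff dest: arcs_symmetric)
  have irr: "x \<notin> nbrs H x" for x by (auto simp: mem_nbrs_iff dest: no_loops')
  have in_verts: "x \<in> pverts H" "y \<in> pverts H" if "y \<in> nbrs H x" for x y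
    using that by (auto simp: mem_nbrs_iff dest: in_arcsD1 in_arcsD2)
  have e_nb: "e \<in> nbrs H a" "e \<in> nbrs H b" using e sym by blast+
  have vs: "a \<in> pverts H" "e \<in> pverts H" "a \<noteq> e" "a' \<noteq> a" "a' \<noteq> e"
    using e_nb in_verts irr a' by blast+

  \<comment> \<open>This is a cone with apex \<open>a\<close> except for \<open>b\<close>, so \<open>b\<close> is the vertex to take off first.\<close>
  define C where "C = insert a (insert b (nbrs H a))"
  have C_sub: "C \<subseteq> pverts H" using b vs in_verts by (auto simp: C_def)
  have "contractible_graph (induced H C)"
  proof (rule contractible_graph.step[where v = b])
    show "pair_graph (induced H C)" using H C_sub by (rule pair_graph_induced)
    show "b \<in> pverts (induced H C)" by (simp add: C_def induced_def)
    have "C \<inter> nbrs H b = insert e (nbrs H a \<inter> nbrs H b - {e})"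
      using b(3) irr sym e_nb by (auto simp: C_def)
    moreover have "contractible_graph (induced H (insert e (nbrs H a \<inter> nbrs H b - {e})))"
      using H vs e by (intro contractible_cone) auto
    ultimately show "contractible_graph (unit_sphere (induced H C) b)"
      by (simp add: unit_sphere_induced C_def)
    have "C - {b} = insert a (nbrs H a)" using b by (auto simp: C_def)
    then show "contractible_graph (remove_vert (induced H C) b)"
      using H vs by (simp add: remove_vert_induced contractible_cone)
  qed
  then have step1: "homotopy_step H (attach_vert H a' C)"
    using C_sub a' by (intro homotopy_step.extend)

  define H1 where "H1 = attach_vert H a' C"
  have H1: "pair_graph H1"
    unfolding H1_def using H C_sub a' by (rule pair_graph_attach_vert)
  have verts1: "pverts H1 = insert a' (pverts H)" by (simp add: H1_def attach_vert_def)
  have nbrs1: "nbrs H1 a' = C" "\<And>x. x \<in> C \<Longrightarrow> nbrs H1 x = insert a' (nbrs H x)"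
    using a' C_sub
    by (auto simp: H1_def attach_vert_def mem_nbrs_iff dest: in_arcsD1 in_arcsD2)

  have "unit_sphere H1 a = induced H1 (insert a' (nbrs H a))"
    by (simp add: unit_sphere_def nbrs1 C_def)
  also have "contractible_graph \<dots>"
    using H1 verts1 nbrs1 by (intro contractible_cone) (auto simp: C_def)
  finally have step2: "homotopy_step H1 (remove_vert H1 a)"
    using vs verts1 by (intro homotopy_step.remove) auto

  have "unit_sphere (remove_vert H1 a) e = induced H1 ((pverts H1 - {a}) \<inter> nbrs H1 e)"
    using vs verts1 by (simp add: remove_vert_def unit_sphere_induced)
  also have "(pverts H1 - {a}) \<inter> nbrs H1 e = insert a' (nbrs H e - {a})"
    using nbrs1(2)[of e] e_nb in_verts verts1 vs by (auto simp: C_def)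
  also have "contractible_graph (induced H1 \<dots>)"
    using H1 verts1 nbrs1(1) e by (intro contractible_cone) (auto simp: C_def)
  finally have step3: "homotopy_step (remove_vert H1 a) (remove_vert (remove_vert H1 a) e)"
    using vs verts1 by (intro homotopy_step.remove) (auto simp: remove_vert_def induced_def)

  from step1 step2 step3 show ?thesis
    unfolding H1_def C_def
    by (blast intro: rtranclp.rtrancl_refl rtranclp.rtrancl_into_rtrancl)
qed

section \<open>Renaming vertices\<close>

definition rename_verts :: "('a \<Rightarrow> 'b) \<Rightarrow> 'a pair_pre_digraph \<Rightarrow> 'b pair_pre_digraph" where
  "rename_verts f G = \<lparr>pverts = f ` pverts G, parcs = map_prod f f ` parcs G\<rparr>"

lemma digraph_iso_rename_verts:
  assumes "pair_wf_digraph G" "inj_on f (pverts G)"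
  shows "digraph_iso (with_proj G) (with_proj (rename_verts f G))"
proof -
  interpret pair_wf_digraph G by fact
  let ?h = "\<lparr>iso_verts = f, iso_arcs = map_prod f f, iso_head = snd, iso_tail = fst\<rparr>"
  have "inj_on (map_prod f f) (parcs G)"
    using map_prod_inj_on[OF assms(2) assms(2)]
    by (rule inj_on_subset) (auto dest: in_arcsD1 in_arcsD2)
  then have "digraph_isomorphism ?h"
    using assms(2) wf_digraph_axioms by (simp add: digraph_isomorphism_def)
  moreover have "with_proj (rename_verts f G) = app_iso ?h (with_proj G)"
    by (simp add: app_iso_def rename_verts_def with_proj_def)
  ultimately show ?thesis unfolding digraph_iso_def by blast
qed

lemma pair_graph_rename_verts:
  assumes "pair_graph G" "inj_on f (pverts G)"
  shows "pair_graph (rename_verts f G)"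
proof -
  interpret pair_graph G by fact
  have "f x \<noteq> f y" if "(x, y) \<in> parcs G" for x y
    using that assms(2) by (metis in_arcsD1 in_arcsD2 inj_onD no_loops')
  then show ?thesis
    by unfold_locales
       (use assms(2) in \<open>auto simp: rename_verts_def symmetric_def pair_finite_verts
          pair_finite_arcs intro!: symI imageI dest: arcs_symmetric in_arcsD1 in_arcsD2\<close>)
qed

lemma nbrs_rename_verts:
  assumes "pair_wf_digraph G" "inj_on f (pverts G)" "x \<in> pverts G"
  shows "nbrs (rename_verts f G) (f x) = f ` nbrs G x"
proof -
  interpret pair_wf_digraph G by fact
  show ?thesis using assms(2,3)
    by (force simp: mem_nbrs_iff rename_verts_def dest: in_arcsD1 in_arcsD2 inj_onD)
qed

section \<open>The edge refinement\<close>

lemma parcs_exchange: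
  assumes "parcs K \<subseteq> pverts K \<times> pverts K" "C \<subseteq> pverts K" "v \<noteq> x" "v \<noteq> y"
  shows "parcs (remove_vert (remove_vert (attach_vert K v C) x) y) =
    parcs K \<inter> {(p, q). p \<notin> {x, y} \<and> q \<notin> {x, y}} \<union> {v} \<times> (C - {x, y}) \<union> (C - {x, y}) \<times> {v}"
  using assms by (auto simp: remove_vert_def induced_def attach_vert_def)

context
  fixes G :: "'a pair_pre_digraph" and a b :: 'a
  assumes G: "pair_graph G" and ab: "(a, b) \<in> parcs G"
begin

interpretation pair_graph G by (rule G)

lemma pverts_edge_refinement: "pverts (edge_refinement G (a, b)) = insert None (Some ` pverts G)"
  by (simp add: edge_refinement_def attach_vert_def)

lemma nbrs_edge_refinement_None:
  "nbrs (edge_refinement G (a, b)) None = Some ` ({a, b} \<union> nbrs G a \<inter> nbrs G b)"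
  by (auto simp: edge_refinement_def attach_vert_def mem_nbrs_iff pverts_unit_sphere)

lemma nbrs_edge_refinement_fst:
  "nbrs (edge_refinement G (a, b)) (Some a) = insert None (Some ` (nbrs G a - {b}))"
  using ab by (auto simp: edge_refinement_def attach_vert_def mem_nbrs_iff pverts_unit_sphere
      dest: no_loops')

lemma nbrs_edge_refinement_snd:
  "nbrs (edge_refinement G (a, b)) (Some b) = insert None (Some ` (nbrs G b - {a}))"
  using ab by (auto simp: edge_refinement_def attach_vert_def mem_nbrs_iff pverts_unit_sphere
      dest: no_loops')

lemma parcs_edge_refinement_avoiding_fst:
  "(Some x, Some y) \<in> parcs (edge_refinement G (a, b)) \<longleftrightarrow> (x, y) \<in> parcs G"
  if "x \<noteq> a" "y \<noteq> a"
  using that by (auto simp: edge_refinement_def attach_vert_def)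

text \<open>The exchange restores the lost edge: \<open>a'\<close> is attached to the images of the neighbours of \<open>a\<close>
  in the refinement and of \<open>b\<close>, and once \<open>a\<close> and the refining vertex are gone these are exactly
  the images of the neighbours of \<open>a\<close> in \<open>G\<close>.  Arcs away from \<open>a\<close> were never changed by the
  refinement.\<close>

lemma exchanged_endpoint_eq_rename_verts:
  fixes g :: "'a option \<Rightarrow> 'c" and a' :: 'c
  assumes g: "inj_on g (pverts (edge_refinement G (a, b)))"
    and a': "a' \<notin> g ` pverts (edge_refinement G (a, b))"
  defines "K \<equiv> rename_verts g (edge_refinement G (a, b))"
  shows "remove_vert (remove_vert (attach_vert K a'
            (insert (g (Some a)) (insert (g (Some b)) (nbrs K (g (Some a)))))) (g (Some a))) (g None)
        = rename_verts (\<lambda>x. if x = a then a' else g (Some x)) G"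
    (is "?L = rename_verts ?h G")
proof -
  let ?R = "edge_refinement G (a, b)"
  have R: "pair_graph ?R" using G ab by (rule pair_graph_edge_refinement)
  interpret R: pair_graph ?R by (rule R)
  have a: "a \<in> pverts G" and b: "b \<in> pverts G" and "a \<noteq> b"
    using ab by (auto dest: in_arcsD1 in_arcsD2 no_loops')
  have g_Some: "g (Some x) = g (Some y) \<longleftrightarrow> x = y" if "x \<in> pverts G" "y \<in> pverts G" for x y
    using inj_on_eq_iff[OF g, of "Some x" "Some y"] that by (simp add: pverts_edge_refinement)
  have g_None: "g (Some x) \<noteq> g None" "g None \<noteq> g (Some x)" if "x \<in> pverts G" for x
    using inj_on_eq_iff[OF g, of "Some x" None] that by (auto simp add: pverts_edge_refinement)
  have nbrs_sub: "nbrs G x \<subseteq> pverts G" for x by (auto simp: mem_nbrs_iff dest: in_arcsD2)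
  have verts: "pverts ?L = ?h ` pverts G"
    using a a' by (auto simp: g_Some g_None remove_vert_def induced_def attach_vert_def K_def
        rename_verts_def pverts_edge_refinement image_iff)
  define N where "N = (\<lambda>x. g (Some x)) ` nbrs G a"
  have N: "insert (g (Some a)) (insert (g (Some b)) (nbrs K (g (Some a)))) - {g (Some a), g None} = N"
  proof -
    have "nbrs K (g (Some a)) = g ` insert None (Some ` (nbrs G a - {b}))"
      unfolding K_def using R.pair_wf_digraph_axioms g a
      by (simp add: nbrs_rename_verts nbrs_edge_refinement_fst pverts_edge_refinement)
    moreover have "g (Some x) \<noteq> g (Some a)" "g (Some x) \<noteq> g None" if "x \<in> nbrs G a" for x
      using that nbrs_sub[of a] a by (auto simp: g_Some g_None subset_iff mem_nbrs_iff
          dest: no_loops')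
    ultimately show ?thesis
      using ab by (auto simp: N_def mem_nbrs_iff)
  qed
  have "parcs K \<inter> {(x, y). x \<notin> {g (Some a), g None} \<and> y \<notin> {g (Some a), g None}}
      = {(g (Some x), g (Some y)) | x y. (x, y) \<in> parcs G \<and> x \<noteq> a \<and> y \<noteq> a}" (is "?A = ?B")
  proof (intro equalityI subrelI)
    fix p q assume "(p, q) \<in> ?A"
    then obtain u v where uv: "(u, v) \<in> parcs ?R" "p = g u" "q = g v"
      and ne: "u \<noteq> Some a" "u \<noteq> None" "v \<noteq> Some a" "v \<noteq> None"
      unfolding K_def rename_verts_def by fastforce
    then obtain x y where "u = Some x" "v = Some y" by blast
    with uv ne show "(p, q) \<in> ?B"
      using parcs_edge_refinement_avoiding_fst[of x y] by auto
  next
    fix p q assume "(p, q) \<in> ?B"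
    then obtain x y where xy: "(x, y) \<in> parcs G" "x \<noteq> a" "y \<noteq> a"
      and pq: "p = g (Some x)" "q = g (Some y)" by blast
    have "(Some x, Some y) \<in> parcs ?R"
      using xy by (simp add: parcs_edge_refinement_avoiding_fst)
    then have "(p, q) \<in> parcs K" using pq by (force simp: K_def rename_verts_def)
    moreover have "g (Some z) \<noteq> g (Some a)" "g (Some z) \<noteq> g None" if "z \<in> {x, y}" for z
      using that xy a by (auto simp: g_Some g_None dest: in_arcsD1 in_arcsD2)
    ultimately show "(p, q) \<in> ?A" using pq by auto
  qed
  moreover have "a' \<noteq> g (Some a)" "a' \<noteq> g None"
    using a a' by (auto simp: pverts_edge_refinement)
  moreover have arcs_K: "parcs K \<subseteq> pverts K \<times> pverts K"
    by (auto simp: K_def rename_verts_def dest: R.in_arcsD1 R.in_arcsD2)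
  moreover have "insert (g (Some a)) (insert (g (Some b)) (nbrs K (g (Some a)))) \<subseteq> pverts K"
    using a b arcs_K by (auto simp: mem_nbrs_iff) (simp_all add: K_def rename_verts_def pverts_edge_refinement)
  ultimately have "parcs ?L = ?B \<union> {a'} \<times> N \<union> N \<times> {a'}"
    using N by (simp add: parcs_exchange)
  also have "\<dots> = map_prod ?h ?h ` parcs G"
  proof (intro equalityI subrelI)
    fix p q assume "(p, q) \<in> ?B \<union> {a'} \<times> N \<union> N \<times> {a'}"
    then consider x y where "(x, y) \<in> parcs G" "x \<noteq> a" "y \<noteq> a" "p = g (Some x)" "q = g (Some y)"
      | y where "(a, y) \<in> parcs G" "p = a'" "q = g (Some y)"
      | x where "(a, x) \<in> parcs G" "p = g (Some x)" "q = a'"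
      by (auto simp: N_def mem_nbrs_iff)
    then obtain x y where "(x, y) \<in> parcs G" "p = ?h x" "q = ?h y"
      by cases (metis arcs_symmetric no_loops')+
    then show "(p, q) \<in> map_prod ?h ?h ` parcs G" by force
  next
    fix p q assume "(p, q) \<in> map_prod ?h ?h ` parcs G"
    then obtain x y where xy: "(x, y) \<in> parcs G" and pq: "p = ?h x" "q = ?h y" by auto
    have "x \<noteq> y" using xy no_loops' by blast
    then consider "x \<noteq> a" "y \<noteq> a" | "x = a" "y \<noteq> a" | "x \<noteq> a" "y = a" by blast
    then show "(p, q) \<in> ?B \<union> {a'} \<times> N \<union> N \<times> {a'}"
      using xy pq arcs_symmetric[OF xy] by cases (auto simp: N_def mem_nbrs_iff)
  qed
  finally show ?thesis
    using verts by (simp add: rename_verts_def)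
qed

end

theorem lemma3:
  fixes G :: "'a pair_pre_digraph" and a b :: 'a
  assumes "pair_graph G"
    and "(a, b) \<in> parcs G"
  shows "homotopic_graphs (edge_refinement G (a, b)) G"
proof -
  let ?R = "edge_refinement G (a, b)"
  interpret G: pair_graph G by fact
  have "pair_graph ?R" using assms by (rule pair_graph_edge_refinement)
  then interpret R: pair_graph ?R .
  obtain g :: "'a option \<Rightarrow> nat" where g: "inj_on g (pverts ?R)"
    using finite_imp_inj_to_nat_seg[OF R.pair_finite_verts] by blast
  obtain a' where a': "a' \<notin> g ` pverts ?R"
    using ex_new_if_finite[OF infinite_UNIV_nat finite_imageI[OF R.pair_finite_verts]] by blast
  define K where "K = rename_verts g ?R"
  define h where "h = (\<lambda>x. if x = a then a' else g (Some x))"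
  have ab: "a \<in> pverts G" "b \<in> pverts G" "a \<noteq> b"
    using assms(2) by (auto dest: G.in_arcsD1 G.in_arcsD2 G.no_loops')
  have nbrs_K: "nbrs K (g x) = g ` nbrs ?R x" if "x \<in> pverts ?R" for x
    unfolding K_def using R.pair_wf_digraph_axioms g that by (rule nbrs_rename_verts)
  note R_simps = pverts_edge_refinement[OF assms] nbrs_edge_refinement_None[OF assms]
    nbrs_edge_refinement_fst[OF assms] nbrs_edge_refinement_snd[OF assms]
  have nbrs_R_sub: "nbrs ?R x \<subseteq> pverts ?R" for x
    by (auto simp: mem_nbrs_iff dest: R.in_arcsD2)

  have "homotopy_step\<^sup>*\<^sup>* K (remove_vert (remove_vert (attach_vert K a'
      (insert (g (Some a)) (insert (g (Some b)) (nbrs K (g (Some a)))))) (g (Some a))) (g None))"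
  proof (rule homotopy_steps_exchange_endpoint)
    show "pair_graph K"
      unfolding K_def using \<open>pair_graph ?R\<close> g by (rule pair_graph_rename_verts)
    show "g (Some b) \<in> pverts K" using ab by (simp add: K_def rename_verts_def R_simps)
    show "g (Some b) \<noteq> g (Some a)" using ab g by (auto simp: R_simps dest: inj_onD)
    show "a' \<notin> pverts K" using a' by (simp add: K_def rename_verts_def)
    have "Some b \<notin> nbrs ?R (Some a)" by (auto simp: R_simps)
    then show "g (Some b) \<notin> nbrs K (g (Some a))"
      using ab inj_on_image_mem_iff[OF g _ nbrs_R_sub] by (simp add: nbrs_K R_simps(1))
    have "nbrs ?R None = {Some a, Some b} \<union> (nbrs ?R (Some a) \<inter> nbrs ?R (Some b) - {None})"
      by (auto simp: R_simps mem_nbrs_iff dest: G.no_loops')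
    then have "nbrs K (g None) = {g (Some a), g (Some b)} \<union>
        g ` (nbrs ?R (Some a) \<inter> nbrs ?R (Some b) - {None})"
      by (simp add: nbrs_K R_simps(1))
    also have "g ` (nbrs ?R (Some a) \<inter> nbrs ?R (Some b) - {None}) =
        nbrs K (g (Some a)) \<inter> nbrs K (g (Some b)) - {g None}"
    proof -
      have "None \<in> pverts ?R" "nbrs ?R (Some a) \<inter> nbrs ?R (Some b) - {None} \<subseteq> pverts ?R"
        using nbrs_R_sub by (auto simp: R_simps(1))
      then show ?thesis
        using ab nbrs_R_sub
        by (simp add: nbrs_K R_simps(1) inj_on_image_set_diff[OF g] inj_on_image_Int[OF g])
    qed
    finally show "nbrs K (g None) = {g (Some a), g (Some b)} \<union>
        (nbrs K (g (Some a)) \<inter> nbrs K (g (Some b)) - {g None})" .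
  qed
  then have "homotopy_step\<^sup>*\<^sup>* K (rename_verts h G)"
    unfolding K_def h_def exchanged_endpoint_eq_rename_verts[OF assms g a'] .
  moreover have "digraph_iso (with_proj ?R) (with_proj K)"
    unfolding K_def using R.pair_wf_digraph_axioms g by (rule digraph_iso_rename_verts)
  moreover have "digraph_iso (with_proj (rename_verts h G)) (with_proj G)"
  proof (rule digraph_iso_swap)
    show "wf_digraph (with_proj G)" by (rule G.wf_digraph_axioms)
    have "inj_on h (pverts G)"
      using g a' by (auto simp: h_def inj_on_def R_simps)
    then show "digraph_iso (with_proj G) (with_proj (rename_verts h G))"
      by (rule digraph_iso_rename_verts[OF G.pair_wf_digraph_axioms])
  qed
  ultimately show ?thesis unfolding homotopic_graphs_def by blast
qed

end
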